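(* Let $\Delta\ge3$ be an integer. Suppose $k>\Delta$ is an integer and $0<\varepsilon<1$ are such that there exists a constant $0<K<1/(\Delta-1)$ with $\theta:=\arcsin(K)\in\big(0,\frac{\pi}{3(\Delta-1+\varepsilon)}\big)$ such that for each $d=0,\dots,\Delta-1$, with $b=\Delta-d$, \[0<\frac{(1+\varepsilon)^2}{(k-b)(1-K)^d-\varepsilon b}\le K.\] Let $G=(V,E)$ be any graph of maximum degree at most $\Delta$ and $(w_e)_{e\in E}$ complex weights such that for each $e\in E$ either (i) $|w_e|\le\varepsilon$, or (ii) $|\arg(w_e)|\le\varepsilon\theta$ and $\varepsilon<|w_e|\le1$. Write $\mathbf{Z}^W_L(G)$ for the restricted partition function with $k$ colours and these weights. Then: (A) For every list $W$ of distinct vertices forming a leaf-independent set in $G$ and every list $L$ of colours with $|L|=|W|$, $\mathbf{Z}^W_L(G)\ne0$. (B) For every list $W=W'u$ of distinct vertices forming a leaf-independent set, and any two colour lists $L'\ell$ and $L'\ell'$ of length $|W|$: (i) the angle between $\mathbf{Z}^{W'u}_{L'\ell}(G)$ and $\mathbf{Z}^{W'u}_{L'\ell'}(G)$ is at most $\theta$; (ii) $\mathbf{Z}^{W'u}_{L'\ell}(G)/\mathbf{Z}^{W'u}_{L'\ell'}(G)\in B(1,K)$. (C) For every list $W=W'u$ of distinct vertices such that $W'$ forms a leaf-independent set in $G$, and every colour list $L'$ of length $|W'|$: let $\mathcal{G}$ and $\mathcal{N}$ be the sets of good and neutral colours for $u$ with respect to $(G,W',L',\varepsilon)$, let $d$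 be the number of free neighbours of $u$ (neighbours not in $W'$) and $b=\Delta-d$. Then (i) $\mathbf{Z}^{W'u}_{L'\ell}(G)\neq0$ for every $\ell\in\mathcal{G}\cup\mathcal{N}$; (ii) for all $\ell,\ell'\in\mathcal{G}\cup\mathcal{N}$ the angle between $\mathbf{Z}^{W'u}_{L'\ell}(G)$ and $\mathbf{Z}^{W'u}_{L'\ell'}(G)$ is at most $(d+b\varepsilon)\theta$; (iii) for all $\ell,j\in\mathcal{G}$, $\mathbf{Z}^{W'u}_{L'\ell}(G)/\mathbf{Z}^{W'u}_{L'j}(G)\in B(1,K)^d$.
   Context: Graphs are simple; $[k]=\{1,\dots,k\}$. For a graph $G=(V,E)$ with complex edge weights $(w_e)$, a list $W=w_1\dots w_m$ of distinct vertices and a list $L=\ell_1\dots\ell_m$ of colours in $[k]$, the restricted partition function is \[\mathbf{Z}^W_L(G)=\sum_{\phi:V\to[k],\ \phi(w_i)=\ell_i\ \forall i}\ \prod_{uv\in E,\ \phi(u)=\phi(v)} w_{uv}.\] $W'u$ and $L'\ell$ denote concatenation of lists. Vertices in $W$ are called fixed (with colour given by $L$); other vertices are free. A set $W\subseteq V$ is leaf-independent if it is an independent set and every vertex in $W$ has degree exactly $1$. Given $\varepsilon>0$, a neighbour $v$ of $u$ is a bad neighbour if $|w_{uv}|\le\varepsilon$. A colour $\ell$ is good for $u$ if no fixed neighbour of $u$ has colour $\ell$; bad if $u$ has at least one fixed bad neighbour coloured $\ell$; neutral if neither good nor bad. Angles between non-zero complex numbers are taken in $[0,\pi]$. $B(a,r)$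 is the open disk of radius $r$ centred at $a$, and $B(a,r)^d=\{b_1\cdots b_d: b_i\in B(a,r)\}$. *)

theory Defs
  imports "HOL-Analysis.Analysis"
begin

definition simple_graph :: "'a set \<Rightarrow> 'a set set \<Rightarrow> bool" where
  "simple_graph V Es \<longleftrightarrow> finite V \<and> (\<forall>e\<in>Es. e \<subseteq> V \<and> card e = 2)"

definition adj :: "'a set set \<Rightarrow> 'a \<Rightarrow> 'a \<Rightarrow> bool" where
  "adj Es u v \<longleftrightarrow> {u, v} \<in> Es"

definition degree :: "'a set \<Rightarrow> 'a set set \<Rightarrow> 'a \<Rightarrow> nat" where
  "degree V Es u = card {v\<in>V. adj Es u v}"

definition max_degree_le :: "'a set \<Rightarrow> 'a set set \<Rightarrow> nat \<Rightarrow> bool" where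
  "max_degree_le V Es D \<longleftrightarrow> (\<forall>u\<in>V. degree V Es u \<le> D)"

definition leaf_independent :: "'a set \<Rightarrow> 'a set set \<Rightarrow> 'a set \<Rightarrow> bool" where
  "leaf_independent V Es W \<longleftrightarrow> W \<subseteq> V \<and> (\<forall>x\<in>W. \<forall>y\<in>W. \<not> adj Es x y)
      \<and> (\<forall>x\<in>W. degree V Es x = 1)"

definition Zr :: "nat \<Rightarrow> 'a set \<Rightarrow> 'a set set \<Rightarrow> ('a set \<Rightarrow> complex)
                  \<Rightarrow> 'a list \<Rightarrow> nat list \<Rightarrow> complex" where
  "Zr k V Es w W L =
     (\<Sum>\<phi> \<in> {\<phi> \<in> V \<rightarrow>\<^sub>E {1..k}. \<forall>i<length W. \<phi> (W ! i) = L ! i}.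
        \<Prod>e \<in> {e \<in> Es. \<exists>c. \<forall>x\<in>e. \<phi> x = c}. w e)"

definition cangle :: "complex \<Rightarrow> complex \<Rightarrow> real" where
  "cangle z1 z2 = \<bar>Arg (z1 / z2)\<bar>"

definition ball_pow :: "complex \<Rightarrow> real \<Rightarrow> nat \<Rightarrow> complex set" where
  "ball_pow a r d = {\<Prod>i<d. b i | b. \<forall>i<d. b i \<in> ball a r}"

definition good_colour :: "'a set set \<Rightarrow> 'a list \<Rightarrow> nat list \<Rightarrow> 'a \<Rightarrow> nat \<Rightarrow> bool" where
  "good_colour Es W L u l \<longleftrightarrow> \<not> (\<exists>i<length W. adj Es u (W ! i) \<and> L ! i = l)"

definition bad_colour :: "'a set set \<Rightarrow> ('a set \<Rightarrow> complex) \<Rightarrow> real \<Rightarrow> 'a list \<Rightarrow> nat list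
                           \<Rightarrow> 'a \<Rightarrow> nat \<Rightarrow> bool" where
  "bad_colour Es w eps W L u l \<longleftrightarrow>
     (\<exists>i<length W. adj Es u (W ! i) \<and> cmod (w {u, W ! i}) \<le> eps \<and> L ! i = l)"

definition neutral_colour :: "'a set set \<Rightarrow> ('a set \<Rightarrow> complex) \<Rightarrow> real \<Rightarrow> 'a list \<Rightarrow> nat list
                           \<Rightarrow> 'a \<Rightarrow> nat \<Rightarrow> bool" where
  "neutral_colour Es w eps W L u l \<longleftrightarrow>
     \<not> good_colour Es W L u l \<and> \<not> bad_colour Es w eps W L u l"

end

theory Submission
  imports Defs
begin

text \<open>Only the free vertices are kept; each fixed neighbour of a free vertex \<open>x\<close> becomes a pin
  (weight, colour) at \<open>x\<close>. By induction on the set \<open>F\<close> of free vertices, the partition function is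
  nonzero, and recolouring a single pin multiplies it by a factor in \<open>B(1, K)\<close>. For the step, pick
  \<open>v\<close> in \<open>F\<close> and expand over the colour \<open>c\<close> of \<open>v\<close>: the partition function is the sum of
  \<open>p c * X c\<close>, where \<open>p c\<close> collects the pins at \<open>v\<close> and \<open>X c\<close> is the partition function on
  \<open>F - {v}\<close> with a pin of colour \<open>c\<close> at each of the \<open>d\<close> neighbours of \<open>v\<close>. Recolouring these pins
  one at a time gives \<open>X c / X j \<in> B(1, K)\<^sup>d\<close>. Elements of \<open>B(1, K)\<^sup>d\<close> have real part at least
  \<open>(1 - K)\<^sup>d\<close> when \<open>d * K \<le> 1\<close>, so after division by the largest \<open>X c\<close> the sum has modulus at
  least \<open>(k - b) (1 - K)\<^sup>d - eps * b\<close>, whereas recolouring a pin at \<open>v\<close> changes it by at most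
  \<open>(1 + eps)\<^sup>2\<close>. Since fixing a vertex introduces pins rather than split copies of the vertex, no
  new vertices are ever needed.\<close>

section \<open>Products of complex numbers near 1\<close>

lemma abs_Arg_mult_le: "\<bar>Arg (z * w)\<bar> \<le> \<bar>Arg z\<bar> + \<bar>Arg w\<bar>"
proof (cases "z = 0 \<or> w = 0")
  case True
  then show ?thesis by (auto simp: Arg_zero)
next
  case False
  then show ?thesis
    using Arg_bounded[of z] Arg_bounded[of w] by (auto simp: Arg_times')
qed

lemma abs_Arg_divide_le: "\<bar>Arg (z / w)\<bar> \<le> \<bar>Arg z\<bar> + \<bar>Arg w\<bar>"
  using abs_Arg_mult_le[of z "inverse w"] by (simp add: divide_inverse Arg_inverse split: if_splits)

lemma abs_Arg_prod_le: "\<bar>Arg (\<Prod>i\<in>I. b i)\<bar> \<le> (\<Sum>i\<in>I. \<bar>Arg (b i)\<bar>)"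
proof (induction I rule: infinite_finite_induct)
  case (insert i I)
  then show ?case
    using abs_Arg_mult_le[of "b i" "\<Prod>i\<in>I. b i"] by simp
qed simp_all

lemma abs_Arg_le_arcsin:
  assumes near: "cmod (b - 1) \<le> r" and "r < 1"
  shows "\<bar>Arg b\<bar> \<le> arcsin r"
proof -
  have "1 - Re b \<le> cmod (b - 1)"
    using abs_Re_le_cmod[of "b - 1"] by simp
  then have Re_pos: "0 < Re b"
    using assms by linarith
  then have "b \<noteq> 0" by auto
  have "Im b = Im ((b - 1) * cnj b)"
    by (simp add: algebra_simps)
  then have "\<bar>Im b\<bar> \<le> cmod (b - 1) * cmod b"
    by (metis abs_Im_le_cmod complex_mod_cnj norm_mult)
  also have "\<dots> \<le> r * cmod b"
    using near by (intro mult_right_mono) auto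
  finally have "\<bar>sin (Arg b)\<bar> \<le> r"
    using \<open>b \<noteq> 0\<close> by (simp add: sin_Arg field_simps)
  then have sin_le: "sin \<bar>Arg b\<bar> \<le> r"
    by (auto simp: abs_if split: if_splits)
  have "\<bar>Arg b\<bar> < pi / 2"
    using Re_pos Arg_Re_pos by blast
  then have "\<bar>Arg b\<bar> = arcsin (sin \<bar>Arg b\<bar>)"
    by (intro arcsin_sin[symmetric]) auto
  also have "\<dots> \<le> arcsin r"
    using sin_le \<open>r < 1\<close> by (intro arcsin_le_arcsin) auto
  finally show ?thesis .
qed

lemma cmod_diff_le_max:
  assumes "\<bar>Arg (x / y)\<bar> \<le> pi / 3"
  shows "cmod (x - y) \<le> max (cmod x) (cmod y)"
proof (cases "y = 0")
  case False
  have "cmod x * cmod y * (1 / 2) \<le> cmod x * cmod y * cos \<bar>Arg (x / y)\<bar>"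
    using assms cos_monotone_0_pi_le[of "\<bar>Arg (x / y)\<bar>" "pi / 3"]
    by (intro mult_left_mono) (auto simp: cos_60)
  also have "\<dots> = Re (x * cnj y)"
  proof -
    have "x * cnj y = of_real ((cmod y)\<^sup>2) * (x / y)"
      unfolding complex_norm_square using False by simp
    also have "\<dots> = rcis (cmod x * cmod y) (Arg (x / y))"
      using False rcis_cmod_Arg[of "x / y"]
      by (simp add: norm_divide power2_eq_square rcis_def field_simps)
    finally show ?thesis by simp
  qed
  finally have "(cmod (x - y))\<^sup>2 \<le> (cmod x)\<^sup>2 + (cmod y)\<^sup>2 - cmod x * cmod y"
    unfolding cmod_power2 by (simp add: power2_eq_square algebra_simps)
  also have "\<dots> \<le> (max (cmod x) (cmod y))\<^sup>2"
    using mult_right_mono[of "cmod x" "cmod y" "cmod x"] mult_right_mono[of "cmod y" "cmod x" "cmod y"]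
    by (auto simp: max_def power2_eq_square mult.commute)
  finally show ?thesis
    by (rule power2_le_imp_le) (auto simp: max_def)
qed simp

lemma abs_Im_prod_le:
  assumes "\<And>i. i \<in> I \<Longrightarrow> cmod (u i) \<le> 1"
  shows "\<bar>Im (\<Prod>i\<in>I. u i)\<bar> \<le> (\<Sum>i\<in>I. \<bar>Im (u i)\<bar>)"
  using assms
proof (induction I rule: infinite_finite_induct)
  case (insert i I)
  define v where "v = (\<Prod>i\<in>I. u i)"
  have "cmod (u i) \<le> 1" "cmod v \<le> 1"
    using insert.prems by (auto simp: v_def prod_norm[symmetric] intro: prod_le_1)
  then have "\<bar>Re (u i)\<bar> \<le> 1" "\<bar>Re v\<bar> \<le> 1"
    using abs_Re_le_cmod order_trans by blast+
  then have "\<bar>Re (u i)\<bar> * \<bar>Im v\<bar> \<le> 1 * \<bar>Im v\<bar>" "\<bar>Im (u i)\<bar> * \<bar>Re v\<bar> \<le> \<bar>Im (u i)\<bar> * 1"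
    by (intro mult_mono; simp)+
  then have "\<bar>Im (u i * v)\<bar> \<le> \<bar>Im (u i)\<bar> + \<bar>Im v\<bar>"
    by (simp add: abs_mult[symmetric])
  then show ?case
    using insert by (auto simp: v_def)
qed auto

lemma mult_eq_of_Re_mult_maximal:
  assumes z_le: "cmod z \<le> r"
    and maximal: "\<And>x. cmod x \<le> r \<Longrightarrow> Re (q * x) \<le> Re (q * z)"
  shows "q * z = of_real (r * cmod q)"
proof -
  have "0 \<le> r"
    using z_le norm_ge_zero order_trans by blast
  have "q * cnj (sgn q) = of_real (cmod q)"
    by (cases "q = 0") (simp_all add: sgn_eq complex_norm_square[symmetric] power2_eq_square)
  then have "r * cmod q = Re (q * (of_real r * cnj (sgn q)))"
    by (metis Re_complex_of_real mult.left_commute of_real_mult)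
  also have "\<dots> \<le> Re (q * z)"
    using \<open>0 \<le> r\<close> by (intro maximal) (simp add: norm_mult norm_sgn)
  finally have "r * cmod q \<le> Re (q * z)" .
  moreover have "cmod (q * z) \<le> r * cmod q"
    using mult_left_mono[OF z_le, of "cmod q"] by (simp add: norm_mult mult.commute)
  ultimately have Re_eq: "Re (q * z) = cmod (q * z)" "cmod (q * z) = r * cmod q"
    using complex_Re_le_cmod[of "q * z"] by linarith+
  from Re_eq(1) have "Im (q * z) = 0"
    by (intro Im_eq_0) simp
  then show ?thesis
    using Re_eq by (intro complex_eqI) (simp_all only: Re_complex_of_real Im_complex_of_real)
qed

lemma polydisc_Re_prod_minimiser:
  assumes "0 \<le> r"
  obtains b :: "'i \<Rightarrow> complex" where "\<And>i. i \<in> I \<Longrightarrow> cmod (b i - 1) \<le> r"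
    and "\<And>b'. (\<And>i. i \<in> I \<Longrightarrow> cmod (b' i - 1) \<le> r) \<Longrightarrow> Re (\<Prod>i\<in>I. b i) \<le> Re (\<Prod>i\<in>I. b' i)"
proof -
  define B :: "('i \<Rightarrow> complex) set" where "B = (\<Pi>\<^sub>E i\<in>UNIV. if i \<in> I then cball 1 r else {1})"
  have "compact B"
    unfolding B_def compactin_euclidean_iff[symmetric] euclidean_product_topology[symmetric]
      compactin_PiE by auto
  moreover have "(\<lambda>_. 1) \<in> B"
    using assms by (auto simp: B_def)
  moreover have "continuous_on B (\<lambda>b. Re (\<Prod>i\<in>I. b i))"
    by (intro continuous_intros continuous_on_subset[OF continuous_on_product_coordinates]) auto
  ultimately obtain b where "b \<in> B"
    and minimal: "\<And>b'. b' \<in> B \<Longrightarrow> Re (\<Prod>i\<in>I. b i) \<le> Re (\<Prod>i\<in>I. b' i)"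
    by (metis continuous_attains_inf empty_iff)
  show ?thesis
  proof
    show "cmod (b i - 1) \<le> r" if "i \<in> I" for i
      using \<open>b \<in> B\<close> that
      by (auto simp: B_def PiE_iff dist_norm norm_minus_commute dest!: spec[of _ i])
  next
    fix b' :: "'i \<Rightarrow> complex"
    assume "\<And>i. i \<in> I \<Longrightarrow> cmod (b' i - 1) \<le> r"
    then have "(\<lambda>i. if i \<in> I then b' i else 1) \<in> B"
      by (auto simp: B_def dist_norm norm_minus_commute)
    from minimal[OF this] show "Re (\<Prod>i\<in>I. b i) \<le> Re (\<Prod>i\<in>I. b' i)"
      by simp
  qed
qed

lemma Im_sgn_eq_of_Re_prod_minimal:
  assumes "finite I" and i_in: "i \<in> I" and "r < 1"
    and near: "\<And>i. i \<in> I \<Longrightarrow> cmod (b i - 1) \<le> r"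
    and minimal: "\<And>b'. (\<And>i. i \<in> I \<Longrightarrow> cmod (b' i - 1) \<le> r) \<Longrightarrow>
      Re (\<Prod>i\<in>I. b i) \<le> Re (\<Prod>i\<in>I. b' i)"
  shows "Im (sgn (b i)) = r * Im (sgn (\<Prod>i\<in>I. b i))"
proof -
  define q where "q = (\<Prod>i\<in>I - {i}. b i)"
  have prod: "(\<Prod>i\<in>I. b i) = b i * q"
    unfolding q_def using assms by (intro prod.remove) auto
  have nonzero: "b j \<noteq> 0" if "j \<in> I" for j
    using near[OF that] \<open>r < 1\<close> by auto
  then have "q \<noteq> 0"
    using assms by (simp add: q_def)
  have "q * (1 - b i) = of_real (r * cmod q)"
  proof (rule mult_eq_of_Re_mult_maximal)
    show "cmod (1 - b i) \<le> r"
      using near[OF i_in] by (simp add: norm_minus_commute)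
    fix x assume "cmod x \<le> r"
    then have "Re (\<Prod>i\<in>I. b i) \<le> Re (\<Prod>j\<in>I. (b(i := 1 - x)) j)"
      using near by (intro minimal) auto
    also have "(\<Prod>j\<in>I. (b(i := 1 - x)) j) = (1 - x) * q"
      unfolding q_def using assms by (subst prod.remove[OF _ i_in]) (auto intro!: prod.cong)
    finally show "Re (q * x) \<le> Re (q * (1 - b i))"
      by (simp add: prod algebra_simps)
  qed
  then have "sgn q * (1 - b i) = of_real r"
    using \<open>q \<noteq> 0\<close> by (simp add: sgn_eq field_simps)
  then have "sgn (\<Prod>i\<in>I. b i) * (1 - b i) = of_real r * sgn (b i)"
    by (simp add: prod sgn_mult ac_simps)
  moreover have "b i = of_real (cmod (b i)) * sgn (b i)"
    using nonzero[OF i_in] by (simp add: sgn_eq)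
  moreover have "sgn (b i) * cnj (sgn (b i)) = 1"
      "sgn (\<Prod>i\<in>I. b i) * cnj (sgn (\<Prod>i\<in>I. b i)) = 1"
    using nonzero i_in \<open>q \<noteq> 0\<close>
    by (simp_all add: complex_norm_square[symmetric] norm_sgn prod)
  ultimately have "cnj (sgn (b i)) = of_real (cmod (b i)) + of_real r * cnj (sgn (\<Prod>i\<in>I. b i))"
    by algebra
  from arg_cong[OF this, of Im] show ?thesis
    by (simp del: Im_sgn)
qed

text \<open>Let \<open>s\<close> be the sign of the product at a minimiser. Every factor has a sign with imaginary part
  \<open>r * Im s\<close>, so \<open>\<bar>Im s\<bar> \<le> card I * r * \<bar>Im s\<bar>\<close>. Hence \<open>s\<close> and all the factors are real.\<close>

lemma Re_prod_ge:
  assumes "finite I" and card_r: "real (card I) * r < 1"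
    and near: "\<And>i. i \<in> I \<Longrightarrow> cmod (a i - 1) \<le> r"
  shows "(1 - r) ^ card I \<le> Re (\<Prod>i\<in>I. a i)"
proof (cases "I = {}")
  case False
  then have "0 \<le> r"
    using near norm_ge_zero order_trans by blast
  then have "1 * r \<le> real (card I) * r"
    using False \<open>finite I\<close> by (intro mult_right_mono) (auto simp: Suc_le_eq card_gt_0_iff)
  then have "r < 1"
    using card_r by simp
  obtain b where b_near: "\<And>i. i \<in> I \<Longrightarrow> cmod (b i - 1) \<le> r"
    and minimal: "\<And>b'. (\<And>i. i \<in> I \<Longrightarrow> cmod (b' i - 1) \<le> r) \<Longrightarrow>
      Re (\<Prod>i\<in>I. b i) \<le> Re (\<Prod>i\<in>I. b' i)"
    using polydisc_Re_prod_minimiser[OF \<open>0 \<le> r\<close>] by blast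
  define s where "s = sgn (\<Prod>i\<in>I. b i)"
  have Im_sgn_b: "Im (sgn (b i)) = r * Im s" if "i \<in> I" for i
    unfolding s_def using \<open>finite I\<close> that \<open>r < 1\<close> b_near minimal
    by (rule Im_sgn_eq_of_Re_prod_minimal)
  have "s = (\<Prod>i\<in>I. sgn (b i))"
    unfolding s_def using \<open>finite I\<close> by (induction I) (simp_all add: sgn_mult)
  then have "\<bar>Im s\<bar> \<le> (\<Sum>i\<in>I. \<bar>Im (sgn (b i))\<bar>)"
    by (simp only:) (rule abs_Im_prod_le, simp add: norm_sgn)
  also have "\<dots> = real (card I) * r * \<bar>Im s\<bar>"
    using Im_sgn_b \<open>0 \<le> r\<close> by (simp add: abs_mult del: Im_sgn)
  finally have "Im s = 0"
    using mult_strict_right_mono[OF card_r, of "\<bar>Im s\<bar>"] by (cases "Im s = 0") simp_all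
  then have "b i = of_real (Re (b i))" if "i \<in> I" for i
    using Im_sgn_b[OF that] by (auto simp: complex_eq_iff)
  then have prod_real: "(\<Prod>i\<in>I. b i) = of_real (\<Prod>i\<in>I. Re (b i))"
    by (simp add: of_real_prod)
  have "1 - r \<le> Re (b i)" if "i \<in> I" for i
    using b_near[OF that] abs_Re_le_cmod[of "b i - 1"] by simp
  then have "(\<Prod>i\<in>I. 1 - r) \<le> (\<Prod>i\<in>I. Re (b i))"
    using \<open>r < 1\<close> by (intro prod_mono) auto
  also have "\<dots> \<le> Re (\<Prod>i\<in>I. a i)"
    using minimal[of a] near by (simp add: prod_real del: of_real_prod)
  finally show ?thesis by simp
qed simp

lemma Re_ball_pow_gt:
  assumes in_pow: "z \<in> ball_pow 1 r d" and d_bounds: "0 < d" "real d * r \<le> 1"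
  shows "(1 - r) ^ d < Re z"
proof -
  obtain b where z_eq: "z = (\<Prod>i<d. b i)" and near: "\<And>i. i < d \<Longrightarrow> cmod (b i - 1) < r"
    using in_pow by (auto simp: ball_pow_def dist_norm norm_minus_commute)
  define s where "s = Max ((\<lambda>i. cmod (b i - 1)) ` {..<d})"
  have "s \<in> (\<lambda>i. cmod (b i - 1)) ` {..<d}"
    unfolding s_def using d_bounds by (intro Max_in) auto
  then have s_bounds: "0 \<le> s" "s < r"
    using near by auto
  have "1 * r \<le> real d * r" "real d * s < real d * r"
    using d_bounds s_bounds by (intro mult_right_mono mult_strict_left_mono; simp)+
  then have "r \<le> 1" "real d * s < 1"
    using d_bounds by linarith+
  have "(1 - r) ^ d < (1 - s) ^ d"
    using s_bounds \<open>r \<le> 1\<close> d_bounds by (intro power_strict_mono) auto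
  also have "\<dots> \<le> Re z"
    unfolding z_eq using Re_prod_ge[of "{..<d}" s b] \<open>real d * s < 1\<close> by (simp add: s_def)
  finally show ?thesis .
qed

lemma abs_Arg_ball_pow_le:
  assumes "z \<in> ball_pow 1 r d" "r < 1"
  shows "\<bar>Arg z\<bar> \<le> real d * arcsin r"
proof -
  obtain b where z_eq: "z = (\<Prod>i<d. b i)" and near: "\<And>i. i < d \<Longrightarrow> cmod (b i - 1) \<le> r"
    using assms(1) by (fastforce simp: ball_pow_def dist_norm norm_minus_commute)
  have "\<bar>Arg z\<bar> \<le> (\<Sum>i<d. \<bar>Arg (b i)\<bar>)"
    unfolding z_eq by (rule abs_Arg_prod_le)
  also have "\<dots> \<le> (\<Sum>i<d. arcsin r)"
    using near \<open>r < 1\<close> by (intro sum_mono abs_Arg_le_arcsin) auto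
  finally show ?thesis by simp
qed

lemma ball_pow_0 [simp]: "ball_pow a r 0 = {1}"
  by (auto simp: ball_pow_def)

lemma mult_in_ball_pow_Suc:
  assumes "x \<in> ball_pow a r d" "y \<in> ball a r"
  shows "x * y \<in> ball_pow a r (Suc d)"
proof -
  obtain b where x_eq: "x = (\<Prod>i<d. b i)" and in_ball: "\<And>i. i < d \<Longrightarrow> b i \<in> ball a r"
    using assms(1) by (auto simp: ball_pow_def)
  have "x * y = (\<Prod>i<Suc d. (b(d := y)) i)"
    by (simp add: x_eq)
  moreover have "\<forall>i<Suc d. (b(d := y)) i \<in> ball a r"
    using in_ball assms by (auto simp: less_Suc_eq)
  ultimately show ?thesis
    unfolding ball_pow_def by blast
qed

lemma ball_pow_nonzero: "z \<in> ball_pow 1 r d \<Longrightarrow> r \<le> 1 \<Longrightarrow> z \<noteq> 0"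
  by (fastforce simp: ball_pow_def)

section \<open>Weighted sums over the colours of one vertex\<close>

type_synonym pin_list = "(complex \<times> nat) list"

definition pin_weight :: "pin_list \<Rightarrow> nat \<Rightarrow> complex" where
  "pin_weight p c = (\<Prod>(a, l)\<leftarrow>p. if l = c then a else 1)"

lemma pin_weight_simps [simp]:
  "pin_weight [] c = 1"
  "pin_weight ((a, l) # p) c = (if l = c then a else 1) * pin_weight p c"
  "pin_weight (p @ p') c = pin_weight p c * pin_weight p' c"
  by (simp_all add: pin_weight_def)

lemma pin_weight_eq_1: "c \<notin> snd ` set p \<Longrightarrow> pin_weight p c = 1"
  by (induction p) auto

lemma card_pinned_colours_le:
  fixes p :: pin_list
  shows "card (snd ` set p \<inter> C) \<le> length p"
proof -
  have "card (snd ` set p \<inter> C) \<le> card (snd ` set p)"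
    by (intro card_mono) auto
  also have "\<dots> \<le> length p"
    using card_length[of "map snd p"] by simp
  finally show ?thesis .
qed

locale potts_parameters =
  fixes D k :: nat and eps K \<theta> :: real
  assumes D_ge_3: "D \<ge> 3"
    and D_less_k: "k > D"
    and eps: "0 < eps" "eps < 1"
    and K: "0 < K" "K < 1 / (real D - 1)"
    and theta_def: "\<theta> = arcsin K"
    and theta: "0 < \<theta>" "\<theta> < pi / (3 * (real D - 1 + eps))"
    and colour_condition: "\<And>d. d \<le> D - 1 \<Longrightarrow>
        0 < (1 + eps)^2 / ((real k - real (D - d)) * (1 - K)^d - eps * real (D - d))
      \<and> (1 + eps)^2 / ((real k - real (D - d)) * (1 - K)^d - eps * real (D - d)) \<le> K"
begin

lemma mult_K_le_1:
  assumes "d \<le> D - 1"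
  shows "real d * K \<le> 1"
proof -
  have "real d * K \<le> (real D - 1) * K"
    using assms D_ge_3 K by (intro mult_right_mono) auto
  also have "\<dots> \<le> 1"
    using K D_ge_3 by (simp add: field_simps)
  finally show ?thesis .
qed

lemma K_less_1: "K < 1"
  using mult_K_le_1[of 2] K D_ge_3 by fastforce

lemma angle_less_pi_third:
  assumes "d \<le> D - 1"
  shows "(real d + real (D - d) * eps) * \<theta> < pi / 3"
proof -
  have "0 \<le> (real D - 1 - real d) * (1 - eps)"
    using assms D_ge_3 eps by (intro mult_nonneg_nonneg) auto
  then have "(real d + real (D - d) * eps) * \<theta> \<le> (real D - 1 + eps) * \<theta>"
    using assms D_ge_3 theta by (intro mult_right_mono) (simp_all add: of_nat_diff algebra_simps)
  also have "\<dots> < pi / 3"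
    using theta D_ge_3 eps by (simp add: field_simps)
  finally show ?thesis .
qed

lemma D_mult_theta_less_pi_half: "real D * \<theta> < pi / 2"
proof -
  have "real D * \<theta> \<le> (3 / 2 * (real D - 1 + eps)) * \<theta>"
    using D_ge_3 eps theta by (intro mult_right_mono) auto
  also have "\<dots> < pi / 2"
    using theta D_ge_3 eps by (simp add: field_simps)
  finally show ?thesis .
qed

definition margin :: "nat \<Rightarrow> real" where
  "margin d = (real k - real (D - d)) * (1 - K)^d - eps * real (D - d)"

lemma margin_ge:
  assumes "d \<le> D - 1"
  shows "(1 + eps)\<^sup>2 / K \<le> margin d"
proof -
  have "0 < (1 + eps)\<^sup>2 / margin d" "(1 + eps)\<^sup>2 / margin d \<le> K"
    using colour_condition[OF assms] by (auto simp: margin_def)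
  then show ?thesis
    using K eps by (auto simp: zero_less_divide_iff field_simps)
qed

text \<open>For \<open>d = 0\<close> the hypothesis is never attained with equality, because then it would fail for
  \<open>d = 1\<close>. This is what makes the ball in (B) open even at a vertex without free neighbours.\<close>

lemma margin_0_gt: "(1 + eps)\<^sup>2 / K < margin 0"
proof -
  have "margin 0 = real k - real D - eps * real D" "0 \<le> eps * real D"
    using eps by (auto simp: margin_def)
  then have "(1 + eps)\<^sup>2 / K \<le> real k - real D"
    using margin_ge[of 0] by linarith
  then have "(1 + eps)\<^sup>2 \<le> K * (real k - real D)"
    using K by (simp add: field_simps)
  moreover have "1 + eps < (1 + eps)\<^sup>2"
    using eps by (simp add: power2_eq_square)
  moreover have "margin 1 = margin 0 + 1 + eps - K * (real k - real D) - K"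
    using D_ge_3 by (simp add: margin_def of_nat_diff algebra_simps)
  moreover have "(1 + eps)\<^sup>2 / K \<le> margin 1"
    using D_ge_3 by (intro margin_ge) simp
  ultimately show ?thesis
    using K by linarith
qed

definition admissible_weight :: "complex \<Rightarrow> bool" where
  "admissible_weight a \<longleftrightarrow>
     cmod a \<le> eps \<or> (\<bar>Arg a\<bar> \<le> eps * \<theta> \<and> eps < cmod a \<and> cmod a \<le> 1)"

definition admissible_pin_list :: "pin_list \<Rightarrow> bool" where
  "admissible_pin_list p \<longleftrightarrow> (\<forall>(a, l) \<in> set p. admissible_weight a)"

definition pinned_bad :: "pin_list \<Rightarrow> nat \<Rightarrow> bool" where
  "pinned_bad p c \<longleftrightarrow> (\<exists>a. (a, c) \<in> set p \<and> cmod a \<le> eps)"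

lemma admissible_pin_list_simps [simp]:
  "admissible_pin_list []"
  "admissible_pin_list ((a, l) # p) \<longleftrightarrow> admissible_weight a \<and> admissible_pin_list p"
  "admissible_pin_list (p @ p') \<longleftrightarrow> admissible_pin_list p \<and> admissible_pin_list p'"
  by (auto simp: admissible_pin_list_def)

lemma pinned_bad_simps [simp]:
  "\<not> pinned_bad [] c"
  "pinned_bad ((a, l) # p) c \<longleftrightarrow> l = c \<and> cmod a \<le> eps \<or> pinned_bad p c"
  by (auto simp: pinned_bad_def)

lemma cmod_admissible_weight_le_1: "admissible_weight a \<Longrightarrow> cmod a \<le> 1"
  using eps by (auto simp: admissible_weight_def)

lemma cmod_admissible_weight_diff_1_le:
  assumes "admissible_weight a"
  shows "cmod (a - 1) \<le> 1 + eps"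
proof (cases "cmod a \<le> eps")
  case True
  then show ?thesis
    using norm_triangle_ineq4[of a 1] by simp
next
  case False
  then have a_bounds: "\<bar>Arg a\<bar> \<le> eps * \<theta>" "cmod a \<le> 1"
    using assms by (auto simp: admissible_weight_def)
  have "eps * \<theta> \<le> (real (D - 1) + real (D - (D - 1)) * eps) * \<theta>"
    using D_ge_3 theta by (intro mult_right_mono) auto
  also have "\<dots> < pi / 3"
    by (rule angle_less_pi_third) simp
  finally show ?thesis
    using a_bounds eps cmod_diff_le_max[of a 1] by simp
qed

lemma cmod_pin_weight_le_1:
  assumes "admissible_pin_list p"
  shows "cmod (pin_weight p c) \<le> 1"
  using assms
proof (induction p)
  case (Cons q p)
  then show ?case
    by (cases q) (auto simp: norm_mult intro!: mult_le_one cmod_admissible_weight_le_1)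
qed simp

lemma cmod_pin_weight_le_eps:
  assumes "admissible_pin_list p" "pinned_bad p c"
  shows "cmod (pin_weight p c) \<le> eps"
proof -
  obtain a p1 p2 where p_eq: "p = p1 @ (a, c) # p2" and a_le: "cmod a \<le> eps"
    using assms(2) unfolding pinned_bad_def by (meson split_list)
  then have "cmod (pin_weight p1 c * pin_weight p2 c) \<le> 1"
    using assms(1) by (auto simp: norm_mult intro!: mult_le_one cmod_pin_weight_le_1)
  then have "cmod a * cmod (pin_weight p1 c * pin_weight p2 c) \<le> eps * 1"
    using a_le eps by (intro mult_mono) auto
  then show ?thesis
    by (simp add: p_eq norm_mult mult_ac)
qed

lemma pin_weight_nonzero: "\<not> pinned_bad p c \<Longrightarrow> pin_weight p c \<noteq> 0"
proof (induction p)
  case (Cons q p)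
  then show ?case
    using eps by (cases q) auto
qed simp

lemma abs_Arg_pin_weight_le:
  assumes "admissible_pin_list p" "\<not> pinned_bad p c"
  shows "\<bar>Arg (pin_weight p c)\<bar> \<le> real (count_list (map snd p) c) * (eps * \<theta>)"
  using assms
proof (induction p)
  case (Cons q p)
  obtain a l where q_eq: "q = (a, l)"
    by (cases q)
  show ?case
  proof (cases "l = c")
    case True
    then have "\<bar>Arg a\<bar> \<le> eps * \<theta>"
      using Cons.prems by (auto simp: q_eq admissible_weight_def)
    then show ?thesis
      using True Cons abs_Arg_mult_le[of a "pin_weight p c"] by (simp add: q_eq algebra_simps)
  next
    case False
    then show ?thesis
      using Cons by (simp add: q_eq)
  qed
qed simp

lemma abs_Arg_pin_weight_ratio_le:
  assumes admissible: "admissible_pin_list p"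
    and not_bad: "\<not> pinned_bad p l" "\<not> pinned_bad p j"
  shows "\<bar>Arg (pin_weight p l / pin_weight p j)\<bar> \<le> real (length p) * (eps * \<theta>)"
proof (cases "l = j")
  case True
  then show ?thesis
    using pin_weight_nonzero[OF not_bad(1)] eps theta by simp
next
  case False
  have "\<bar>Arg (pin_weight p l / pin_weight p j)\<bar>
      \<le> real (count_list (map snd p) l + count_list (map snd p) j) * (eps * \<theta>)"
    using abs_Arg_divide_le[of "pin_weight p l" "pin_weight p j"]
      abs_Arg_pin_weight_le[OF admissible not_bad(1)] abs_Arg_pin_weight_le[OF admissible not_bad(2)]
    by (simp add: algebra_simps)
  also have "count_list (map snd p) l + count_list (map snd p) j \<le> length p"
    using False by (induction p) auto
  finally show ?thesis
    using eps theta by (simp add: mult_right_mono)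
qed

lemma abs_Arg_pin_weight_ratio_mult_le:
  assumes admissible: "admissible_pin_list p" and not_bad: "\<not> pinned_bad p l" "\<not> pinned_bad p j"
    and length_le: "length p \<le> D - d" and in_pow: "y \<in> ball_pow 1 K d"
  shows "\<bar>Arg (pin_weight p l / pin_weight p j * y)\<bar> \<le> (real d + real (D - d) * eps) * \<theta>"
proof -
  have "\<bar>Arg (pin_weight p l / pin_weight p j * y)\<bar> \<le> real (length p) * (eps * \<theta>) + real d * \<theta>"
    using abs_Arg_mult_le[of "pin_weight p l / pin_weight p j" y]
      abs_Arg_pin_weight_ratio_le[OF admissible not_bad]
      abs_Arg_ball_pow_le[OF in_pow K_less_1, folded theta_def]
    by linarith
  also have "\<dots> \<le> real (D - d) * (eps * \<theta>) + real d * \<theta>"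
    using length_le eps theta by (intro add_right_mono mult_right_mono) auto
  finally show ?thesis
    by (simp add: algebra_simps)
qed

lemma Re_pin_weight_mult_ge:
  assumes admissible: "admissible_pin_list p" and length_le: "length p \<le> D - d"
    and d_le: "d \<le> D - 1" and y_bounds: "y \<in> ball_pow 1 K d" "cmod y \<le> 1"
  shows "(if c \<in> snd ` set p then - eps else (1 - K) ^ d) \<le> Re (pin_weight p c * y)"
proof -
  consider (unpinned) "c \<notin> snd ` set p"
    | (bad) "c \<in> snd ` set p" "pinned_bad p c"
    | (neutral) "c \<in> snd ` set p" "\<not> pinned_bad p c"
    by blast
  then show ?thesis
  proof cases
    case unpinned
    then show ?thesis
      using y_bounds Re_ball_pow_gt[of y K d] mult_K_le_1[OF d_le]
      by (cases "d = 0") (simp_all add: pin_weight_eq_1)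
  next
    case bad
    have "cmod (pin_weight p c * y) \<le> eps * 1"
      unfolding norm_mult using cmod_pin_weight_le_eps[OF admissible bad(2)] y_bounds eps
      by (intro mult_mono) auto
    then show ?thesis
      using abs_Re_le_cmod[of "pin_weight p c * y"] bad by simp
  next
    case neutral
    obtain j where j_unpinned: "j \<notin> snd ` set p"
      using ex_new_if_finite[of "snd ` set p"] infinite_UNIV_nat by auto
    then have "\<not> pinned_bad p j" by (force simp: pinned_bad_def)
    then have "\<bar>Arg (pin_weight p c * y)\<bar> \<le> (real d + real (D - d) * eps) * \<theta>"
      using abs_Arg_pin_weight_ratio_mult_le[OF admissible neutral(2) _ length_le y_bounds(1), of j]
      by (simp add: pin_weight_eq_1[OF j_unpinned])
    also have "\<dots> < pi / 3"
      by (rule angle_less_pi_third[OF d_le])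
    finally have "0 \<le> Re (pin_weight p c * y)"
      using Arg_Re_nonneg[of "pin_weight p c * y"] pi_gt_zero by linarith
    then show ?thesis
      using neutral eps by simp
  qed
qed

lemma margin_le_sum:
  assumes card_le: "card (C \<inter> {1..k}) \<le> D - d"
  shows "margin d \<le> (\<Sum>c\<in>{1..k}. if c \<in> C then - eps else (1 - K) ^ d)"
proof -
  let ?b = "card (C \<inter> {1..k})"
  have "(real k - real (D - d)) * (1 - K) ^ d \<le> (real k - real ?b) * (1 - K) ^ d"
       "eps * real ?b \<le> eps * real (D - d)"
    using card_le K_less_1 eps by (intro mult_left_mono mult_right_mono; simp)+
  then have "margin d \<le> (real k - real ?b) * (1 - K) ^ d - eps * real ?b"
    by (simp add: margin_def)
  also have "\<dots> = (\<Sum>c\<in>{1..k}. if c \<in> C then - eps else (1 - K) ^ d)"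
  proof -
    have "card ({1..k} - C) = k - ?b"
      using card_Diff_subset_Int[of "{1..k}" C] by (simp add: Int_commute)
    then have "real (card ({1..k} - C)) = real k - real ?b"
      using card_le D_less_k by (simp add: of_nat_diff)
    then show ?thesis
      by (simp add: sum.If_cases Int_commute Diff_eq Compl_eq)
  qed
  finally show ?thesis .
qed

lemma Re_pin_weighted_sum_gt:
  assumes admissible: "admissible_pin_list p" and length_le: "length p \<le> D - d"
    and d_le: "d \<le> D - 1"
    and in_pow: "\<And>c. c \<in> {1..k} \<Longrightarrow> y c \<in> ball_pow 1 K d"
    and le_1: "\<And>c. c \<in> {1..k} \<Longrightarrow> cmod (y c) \<le> 1"
  shows "(1 + eps)\<^sup>2 / K < Re (\<Sum>c\<in>{1..k}. pin_weight p c * y c)"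
proof -
  define lower where "lower c = (if c \<in> snd ` set p then - eps else (1 - K) ^ d)" for c
  have lower_le: "lower c \<le> Re (pin_weight p c * y c)" if "c \<in> {1..k}" for c
    unfolding lower_def using admissible length_le d_le in_pow[OF that] le_1[OF that]
    by (rule Re_pin_weight_mult_ge)
  have few_pinned: "card (snd ` set p \<inter> {1..k}) \<le> D - d"
    using card_pinned_colours_le length_le by (rule order_trans)
  then have margin_le: "margin d \<le> (\<Sum>c\<in>{1..k}. lower c)"
    unfolding lower_def by (rule margin_le_sum)
  show ?thesis
  proof (cases "d = 0")
    case True
    then have "(1 + eps)\<^sup>2 / K < (\<Sum>c\<in>{1..k}. lower c)"
      using margin_0_gt margin_le by simp
    also have "\<dots> \<le> Re (\<Sum>c\<in>{1..k}. pin_weight p c * y c)"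
      unfolding Re_sum by (intro sum_mono lower_le)
    finally show ?thesis .
  next
    case False
    have "\<not> {1..k} \<subseteq> snd ` set p"
      using few_pinned D_less_k by (auto simp: Int_absorb1)
    then obtain c where c_unpinned: "c \<in> {1..k}" "c \<notin> snd ` set p"
      by blast
    then have "lower c < Re (pin_weight p c * y c)"
      using Re_ball_pow_gt[OF in_pow] mult_K_le_1[OF d_le] False
      by (simp add: lower_def pin_weight_eq_1)
    then have "(\<Sum>c\<in>{1..k}. lower c) < Re (\<Sum>c\<in>{1..k}. pin_weight p c * y c)"
      unfolding Re_sum using c_unpinned(1) lower_le by (intro sum_strict_mono_ex1) auto
    then show ?thesis
      using margin_ge[OF d_le] margin_le by simp
  qed
qed

definition ratios_in_ball_pow :: "nat \<Rightarrow> (nat \<Rightarrow> complex) \<Rightarrow> bool" where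
  "ratios_in_ball_pow d X \<longleftrightarrow> (\<forall>l\<in>{1..k}. \<forall>j\<in>{1..k}. X l / X j \<in> ball_pow 1 K d)"

lemma ratios_in_ball_powD:
  "ratios_in_ball_pow d X \<Longrightarrow> l \<in> {1..k} \<Longrightarrow> j \<in> {1..k} \<Longrightarrow> X l / X j \<in> ball_pow 1 K d"
  by (simp add: ratios_in_ball_pow_def)

lemma ratios_in_ball_pow_nonzero:
  assumes "ratios_in_ball_pow d X" "l \<in> {1..k}"
  shows "X l \<noteq> 0"
  using ball_pow_nonzero[OF ratios_in_ball_powD[OF assms(1,2,2)]] K_less_1 by auto

lemma maximal_colourE:
  fixes X :: "nat \<Rightarrow> complex"
  obtains m where "m \<in> {1..k}" "\<And>c. c \<in> {1..k} \<Longrightarrow> cmod (X c) \<le> cmod (X m)"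
proof -
  have "Max ((\<lambda>c. cmod (X c)) ` {1..k}) \<in> (\<lambda>c. cmod (X c)) ` {1..k}"
    using D_less_k by (intro Max_in) auto
  then obtain m where "m \<in> {1..k}" "cmod (X m) = Max ((\<lambda>c. cmod (X c)) ` {1..k})"
    by auto
  then show ?thesis
    using that[of m] by simp
qed

lemma cmod_pin_weighted_sum_gt:
  assumes admissible: "admissible_pin_list p" and length_le: "length p \<le> D - d"
    and d_le: "d \<le> D - 1" and ratios: "ratios_in_ball_pow d X"
    and m_colour: "m \<in> {1..k}" and maximal: "\<And>c. c \<in> {1..k} \<Longrightarrow> cmod (X c) \<le> cmod (X m)"
  shows "(1 + eps)\<^sup>2 / K * cmod (X m) < cmod (\<Sum>c\<in>{1..k}. pin_weight p c * X c)"
proof -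
  have "X m \<noteq> 0"
    using ratios m_colour by (rule ratios_in_ball_pow_nonzero)
  have "(1 + eps)\<^sup>2 / K < Re (\<Sum>c\<in>{1..k}. pin_weight p c * (X c / X m))"
    using admissible length_le d_le ratios m_colour maximal \<open>X m \<noteq> 0\<close>
    by (intro Re_pin_weighted_sum_gt ratios_in_ball_powD) (auto simp: norm_divide)
  also have "\<dots> \<le> cmod (\<Sum>c\<in>{1..k}. pin_weight p c * (X c / X m))"
    by (rule complex_Re_le_cmod)
  also have "\<dots> = cmod (\<Sum>c\<in>{1..k}. pin_weight p c * X c) / cmod (X m)"
    by (simp add: norm_divide[symmetric] sum_divide_distrib)
  finally show ?thesis
    using \<open>X m \<noteq> 0\<close> by (simp add: field_simps)
qed

lemma pin_weighted_sum_nonzero: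
  assumes admissible: "admissible_pin_list p" and length_le: "d + length p \<le> D"
    and ratios: "ratios_in_ball_pow d X"
  shows "(\<Sum>c\<in>{1..k}. pin_weight p c * X c) \<noteq> 0"
proof -
  obtain m where m_colour: "m \<in> {1..k}"
    and maximal: "\<And>c. c \<in> {1..k} \<Longrightarrow> cmod (X c) \<le> cmod (X m)"
    using maximal_colourE[of X] by blast
  have "X m \<noteq> 0"
    using ratios m_colour by (rule ratios_in_ball_pow_nonzero)
  show ?thesis
  proof (cases "d = D")
    case True
    have "0 < Re (X c / X m)" if "c \<in> {1..k}" for c
      using Arg_Re_pos[of "X c / X m"] D_mult_theta_less_pi_half
        ratios_in_ball_pow_nonzero[OF ratios that] \<open>X m \<noteq> 0\<close>
        abs_Arg_ball_pow_le[OF ratios_in_ball_powD[OF ratios that m_colour] K_less_1, folded theta_def]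
      by (auto simp: True)
    then have "0 < Re (\<Sum>c\<in>{1..k}. X c / X m)"
      unfolding Re_sum using D_less_k by (intro sum_pos) auto
    then have "(\<Sum>c\<in>{1..k}. X c) / X m \<noteq> 0"
      unfolding sum_divide_distrib by (auto simp del: Re_sum)
    then show ?thesis
      using length_le True by simp
  next
    case False
    then have "(1 + eps)\<^sup>2 / K * cmod (X m) < cmod (\<Sum>c\<in>{1..k}. pin_weight p c * X c)"
      using admissible length_le ratios m_colour maximal
      by (intro cmod_pin_weighted_sum_gt[where d = d]) auto
    moreover have "0 \<le> (1 + eps)\<^sup>2 / K * cmod (X m)"
      using K by simp
    ultimately show ?thesis by fastforce
  qed
qed

lemma cmod_pin_weight_diff_le:
  assumes admissible: "admissible_pin_list p" and length_le: "length p \<le> D - d"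
    and d_le: "d \<le> D - 1"
    and x_le: "cmod x \<le> M" and y_le: "cmod y \<le> M" and in_pow: "x / y \<in> ball_pow 1 K d"
  shows "cmod (pin_weight p l * x - pin_weight p j * y) \<le> (1 + eps) * M"
proof (cases "pinned_bad p l \<or> pinned_bad p j")
  case True
  have "0 \<le> M"
    using x_le norm_ge_zero order_trans by blast
  have "cmod (pin_weight p l * x - pin_weight p j * y)
      \<le> cmod (pin_weight p l) * M + cmod (pin_weight p j) * M"
    using norm_triangle_ineq4[of "pin_weight p l * x" "pin_weight p j * y"]
      mult_left_mono[OF x_le, of "cmod (pin_weight p l)"]
      mult_left_mono[OF y_le, of "cmod (pin_weight p j)"]
    by (simp add: norm_mult)
  also have "\<dots> = (cmod (pin_weight p l) + cmod (pin_weight p j)) * M"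
    by (simp add: algebra_simps)
  also have "\<dots> \<le> (1 + eps) * M"
    using True \<open>0 \<le> M\<close> cmod_pin_weight_le_1[OF admissible, of l]
      cmod_pin_weight_le_1[OF admissible, of j] cmod_pin_weight_le_eps[OF admissible, of l]
      cmod_pin_weight_le_eps[OF admissible, of j]
    by (intro mult_right_mono) auto
  finally show ?thesis .
next
  case False
  then have "\<bar>Arg (pin_weight p l / pin_weight p j * (x / y))\<bar> \<le> pi / 3"
    using abs_Arg_pin_weight_ratio_mult_le[OF admissible _ _ length_le in_pow]
      angle_less_pi_third[OF d_le]
    by (meson less_imp_le order_trans)
  then have "cmod (pin_weight p l * x - pin_weight p j * y)
      \<le> max (cmod (pin_weight p l * x)) (cmod (pin_weight p j * y))"
    by (intro cmod_diff_le_max) simp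
  also have "\<dots> \<le> 1 * M"
    unfolding norm_mult using x_le y_le cmod_pin_weight_le_1[OF admissible]
    by (intro max.boundedI mult_mono) auto
  also have "\<dots> \<le> (1 + eps) * M"
    using eps x_le norm_ge_zero[of x] by (intro mult_right_mono) linarith+
  finally show ?thesis .
qed

lemma pin_weighted_sum_snoc:
  assumes "l \<in> {1..k}"
  shows "(\<Sum>c\<in>{1..k}. pin_weight (p @ [(a, l)]) c * X c) =
    (\<Sum>c\<in>{1..k}. pin_weight p c * X c) + (a - 1) * (pin_weight p l * X l)"
proof -
  have "(\<Sum>c\<in>{1..k}. pin_weight (p @ [(a, l)]) c * X c) =
      (\<Sum>c\<in>{1..k}. pin_weight p c * X c + (if c = l then (a - 1) * (pin_weight p l * X l) else 0))"
    by (intro sum.cong) (auto simp: algebra_simps)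
  then show ?thesis
    using assms by (simp add: sum.distrib)
qed

lemma recolour_pin_ratio_in_ball:
  assumes admissible: "admissible_pin_list (p @ [(a, l)])" and length_le: "d + Suc (length p) \<le> D"
    and ratios: "ratios_in_ball_pow d X" and colours: "l \<in> {1..k}" "j \<in> {1..k}"
  shows "(\<Sum>c\<in>{1..k}. pin_weight (p @ [(a, l)]) c * X c)
       / (\<Sum>c\<in>{1..k}. pin_weight (p @ [(a, j)]) c * X c) \<in> ball 1 K"
proof -
  define T where "T i = (\<Sum>c\<in>{1..k}. pin_weight (p @ [(a, i)]) c * X c)" for i
  obtain m where m_colour: "m \<in> {1..k}"
    and maximal: "\<And>c. c \<in> {1..k} \<Longrightarrow> cmod (X c) \<le> cmod (X m)"
    using maximal_colourE[of X] by blast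
  have "(1 + eps)\<^sup>2 / K * cmod (X m) < cmod (T j)"
    unfolding T_def using admissible length_le ratios m_colour maximal
    by (intro cmod_pin_weighted_sum_gt[where d = d]) auto
  then have T_gt: "(1 + eps) * ((1 + eps) * cmod (X m)) < K * cmod (T j)"
    using K by (simp add: field_simps power2_eq_square)
  moreover have "0 \<le> (1 + eps) * ((1 + eps) * cmod (X m))"
    using eps by simp
  ultimately have "T j \<noteq> 0"
    by fastforce
  have "cmod (T l - T j) = cmod (a - 1) * cmod (pin_weight p l * X l - pin_weight p j * X j)"
    unfolding T_def pin_weighted_sum_snoc[OF colours(1)] pin_weighted_sum_snoc[OF colours(2)]
      norm_mult[symmetric] by (simp add: algebra_simps)
  also have "\<dots> \<le> (1 + eps) * ((1 + eps) * cmod (X m))"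
    using admissible length_le colours maximal eps ratios_in_ball_powD[OF ratios colours]
    by (intro mult_mono cmod_admissible_weight_diff_1_le cmod_pin_weight_diff_le[where d = d]) auto
  also note T_gt
  finally have "cmod (T l / T j - 1) < K"
    using \<open>T j \<noteq> 0\<close> by (simp add: diff_divide_eq_iff norm_divide field_simps)
  then show ?thesis
    by (simp add: T_def dist_norm norm_minus_commute)
qed

end

section \<open>Pinned partition functions\<close>

definition add_pin :: "('a \<Rightarrow> pin_list) \<Rightarrow> 'a \<Rightarrow> complex \<Rightarrow> nat \<Rightarrow> 'a \<Rightarrow> pin_list" where
  "add_pin P x a l = P(x := P x @ [(a, l)])"

locale potts_model =
  fixes k :: nat and V :: "'a set" and Es :: "'a set set" and w :: "'a set \<Rightarrow> complex"
  assumes simple: "simple_graph V Es"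
begin

definition nbrs :: "'a \<Rightarrow> 'a set" where
  "nbrs v = {x. adj Es v x}"

lemma nbrs_subset: "nbrs v \<subseteq> V"
  using simple by (auto simp: nbrs_def adj_def simple_graph_def)

lemma not_in_nbrs_self: "v \<notin> nbrs v"
  using simple by (auto simp: nbrs_def adj_def simple_graph_def)

lemma nbrs_sym: "x \<in> nbrs v \<longleftrightarrow> v \<in> nbrs x"
  by (simp add: nbrs_def adj_def insert_commute)

lemma degree_eq_card_nbrs: "degree V Es v = card (nbrs v)"
  unfolding degree_def using nbrs_subset[of v]
  by (intro arg_cong[of _ _ card]) (auto simp: nbrs_def)

lemma finite_subset_V: "F \<subseteq> V \<Longrightarrow> finite F"
  using simple by (auto intro: finite_subset simp: simple_graph_def)

lemma finite_Es: "finite Es"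
  using simple by (intro finite_subset[of Es "Pow V"]) (auto simp: simple_graph_def)

definition independent :: "'a set \<Rightarrow> bool" where
  "independent S \<longleftrightarrow> (\<forall>x\<in>S. nbrs x \<inter> S = {})"

lemma leaf_independentD:
  assumes "leaf_independent V Es S"
  shows "S \<subseteq> V" "independent S" "x \<in> S \<Longrightarrow> card (nbrs x) = 1"
  using assms by (auto simp: leaf_independent_def independent_def nbrs_def degree_eq_card_nbrs)

definition monochromatic_edges :: "'a set \<Rightarrow> ('a \<Rightarrow> nat) \<Rightarrow> 'a set set" where
  "monochromatic_edges F \<phi> = {e \<in> Es. e \<subseteq> F \<and> (\<exists>c. \<forall>x\<in>e. \<phi> x = c)}"

definition colouring_weight :: "'a set \<Rightarrow> ('a \<Rightarrow> pin_list) \<Rightarrow> ('a \<Rightarrow> nat) \<Rightarrow> complex" where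
  "colouring_weight F P \<phi> =
     (\<Prod>e\<in>monochromatic_edges F \<phi>. w e) * (\<Prod>x\<in>F. pin_weight (P x) (\<phi> x))"

definition pinned_Zr :: "'a set \<Rightarrow> ('a \<Rightarrow> pin_list) \<Rightarrow> 'a list \<Rightarrow> nat list \<Rightarrow> complex" where
  "pinned_Zr F P W L =
     (\<Sum>\<phi> \<in> {\<phi> \<in> F \<rightarrow>\<^sub>E {1..k}. \<forall>i<length W. \<phi> (W ! i) = L ! i}. colouring_weight F P \<phi>)"

abbreviation pinned_Z :: "'a set \<Rightarrow> ('a \<Rightarrow> pin_list) \<Rightarrow> complex" where
  "pinned_Z F P \<equiv> pinned_Zr F P [] []"

lemma Zr_eq_pinned_Zr: "Zr k V Es w W L = pinned_Zr V (\<lambda>_. []) W L"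
proof -
  have "monochromatic_edges V \<phi> = {e \<in> Es. \<exists>c. \<forall>x\<in>e. \<phi> x = c}" for \<phi>
    using simple by (auto simp: simple_graph_def monochromatic_edges_def)
  then show ?thesis
    by (simp add: Zr_def pinned_Zr_def colouring_weight_def)
qed

lemma pinned_Zr_cong:
  assumes "\<And>x. x \<in> F \<Longrightarrow> P x = Q x"
  shows "pinned_Zr F P W L = pinned_Zr F Q W L"
  using assms by (simp add: pinned_Zr_def colouring_weight_def cong: prod.cong)

lemma pinned_Z_empty: "pinned_Z {} P = 1"
proof -
  have "{} \<notin> Es"
    using simple by (force simp: simple_graph_def)
  then have "monochromatic_edges {} \<phi> = {}" for \<phi>
    by (auto simp: monochromatic_edges_def)
  then show ?thesis
    by (simp add: pinned_Zr_def colouring_weight_def)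
qed

definition attach_pins :: "('a \<Rightarrow> pin_list) \<Rightarrow> 'a set \<Rightarrow> 'a \<Rightarrow> nat \<Rightarrow> 'a \<Rightarrow> pin_list" where
  "attach_pins P S v c x = P x @ (if x \<in> S then [(w {v, x}, c)] else [])"

lemma attach_pins_empty: "attach_pins P {} v c = P"
  by (simp add: attach_pins_def fun_eq_iff)

lemma attach_pins_insert:
  assumes "x \<notin> S"
  shows "attach_pins P (insert x S) v c = add_pin (attach_pins P S v c) x (w {v, x}) c"
  using assms by (auto simp: attach_pins_def add_pin_def fun_eq_iff)

lemma attach_pins_add_pin:
  assumes "x \<notin> S"
  shows "attach_pins (add_pin P x a l) S v c = add_pin (attach_pins P S v c) x a l"
  using assms by (auto simp: attach_pins_def add_pin_def fun_eq_iff)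

lemma monochromatic_edges_upd:
  assumes "v \<in> F"
  shows "monochromatic_edges F (\<phi>(v := c)) =
    monochromatic_edges (F - {v}) \<phi> \<union> (\<lambda>x. {v, x}) ` {x \<in> nbrs v \<inter> F. \<phi> x = c}"
    (is "_ = ?old \<union> ?new")
proof (intro equalityI subsetI)
  fix e
  assume mono: "e \<in> monochromatic_edges F (\<phi>(v := c))"
  show "e \<in> ?old \<union> ?new"
  proof (cases "v \<in> e")
    case True
    have "card e = 2"
      using mono simple by (auto simp: simple_graph_def monochromatic_edges_def)
    then obtain x where "e = {v, x}" "x \<noteq> v"
      using True by (auto simp: card_2_iff)
    then show ?thesis
      using mono by (auto simp: nbrs_def adj_def monochromatic_edges_def)
  next
    case False
    then have "\<And>x. x \<in> e \<Longrightarrow> (\<phi>(v := c)) x = \<phi> x" by auto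
    then show ?thesis
      using mono False by (auto simp: monochromatic_edges_def)
  qed
next
  fix e
  assume "e \<in> ?old \<union> ?new"
  then show "e \<in> monochromatic_edges F (\<phi>(v := c))"
    using assms not_in_nbrs_self[of v] by (auto simp: nbrs_def adj_def monochromatic_edges_def)
qed

lemma colouring_weight_upd:
  assumes F_sub: "F \<subseteq> V" and v_in: "v \<in> F"
  shows "colouring_weight F P (\<phi>(v := c)) =
    pin_weight (P v) c * colouring_weight (F - {v}) (attach_pins P (nbrs v) v c) \<phi>"
proof -
  let ?N = "{x \<in> nbrs v \<inter> F. \<phi> x = c}"
  have finite: "finite (monochromatic_edges (F - {v}) \<phi>)" "finite F"
    using finite_Es finite_subset_V[OF F_sub] by (auto simp: monochromatic_edges_def)
  have "inj_on (\<lambda>x. {v, x}) ?N"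
    by (auto simp: inj_on_def doubleton_eq_iff)
  moreover have "monochromatic_edges (F - {v}) \<phi> \<inter> (\<lambda>x. {v, x}) ` ?N = {}"
    by (auto simp: monochromatic_edges_def)
  ultimately have edges: "(\<Prod>e\<in>monochromatic_edges F (\<phi>(v := c)). w e) =
      (\<Prod>e\<in>monochromatic_edges (F - {v}) \<phi>. w e) * (\<Prod>x\<in>?N. w {v, x})"
    unfolding monochromatic_edges_upd[OF v_in] using finite
    by (simp add: prod.union_disjoint prod.reindex)
  have old_pins: "(\<Prod>x\<in>F. pin_weight (P x) ((\<phi>(v := c)) x)) =
      pin_weight (P v) c * (\<Prod>x\<in>F - {v}. pin_weight (P x) (\<phi> x))"
    using finite v_in by (subst prod.remove[of _ v]) (auto intro!: prod.cong)
  have N_eq: "?N = {x \<in> F - {v}. x \<in> nbrs v \<and> \<phi> x = c}"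
    using not_in_nbrs_self by auto
  have "(\<Prod>x\<in>F - {v}. pin_weight (attach_pins P (nbrs v) v c x) (\<phi> x)) =
      (\<Prod>x\<in>F - {v}. pin_weight (P x) (\<phi> x) * (if x \<in> nbrs v \<and> \<phi> x = c then w {v, x} else 1))"
    by (intro prod.cong) (auto simp: attach_pins_def)
  also have "\<dots> = (\<Prod>x\<in>F - {v}. pin_weight (P x) (\<phi> x)) * (\<Prod>x\<in>?N. w {v, x})"
    unfolding N_eq using finite by (simp only: prod.distrib prod.inter_filter finite_Diff)
  finally show ?thesis
    unfolding colouring_weight_def edges old_pins by (simp only: mult_ac)
qed

lemma pinned_Zr_Cons:
  assumes F_sub: "F \<subseteq> V" and v_in: "v \<in> F" "v \<notin> set W" and W_sub: "set W \<subseteq> F"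
    and colour: "c \<in> {1..k}"
  shows "pinned_Zr F P (v # W) (c # L) =
    pin_weight (P v) c * pinned_Zr (F - {v}) (attach_pins P (nbrs v) v c) W L"
proof -
  let ?A = "{\<phi> \<in> F \<rightarrow>\<^sub>E {1..k}. \<forall>i<length (v # W). \<phi> ((v # W) ! i) = (c # L) ! i}"
  let ?B = "{\<phi> \<in> (F - {v}) \<rightarrow>\<^sub>E {1..k}. \<forall>i<length W. \<phi> (W ! i) = L ! i}"
  have A_eq: "?A = {\<phi> \<in> F \<rightarrow>\<^sub>E {1..k}. \<phi> v = c \<and> (\<forall>i<length W. \<phi> (W ! i) = L ! i)}"
    by (auto simp: nth_Cons split: nat.splits)
  have W_nth: "W ! i \<noteq> v" "W ! i \<in> F" if "i < length W" for i
    using that v_in W_sub by auto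
  have "pinned_Zr F P (v # W) (c # L) = (\<Sum>\<phi>\<in>?B. colouring_weight F P (\<phi>(v := c)))"
    unfolding pinned_Zr_def
  proof (rule sum.reindex_bij_witness[where j = "\<lambda>\<phi>. restrict \<phi> (F - {v})" and i = "\<lambda>\<phi>. \<phi>(v := c)"])
    fix \<phi> assume "\<phi> \<in> ?A"
    then have \<phi>_props: "\<phi> \<in> F \<rightarrow>\<^sub>E {1..k}" "\<phi> v = c" "\<And>i. i < length W \<Longrightarrow> \<phi> (W ! i) = L ! i"
      unfolding A_eq by auto
    show restore: "(restrict \<phi> (F - {v}))(v := c) = \<phi>"
      using PiE_arb[OF \<phi>_props(1)] \<phi>_props(2) by (auto simp: fun_eq_iff)
    show "restrict \<phi> (F - {v}) \<in> ?B"
      using \<phi>_props W_nth by (auto simp: PiE_iff)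
    show "colouring_weight F P ((restrict \<phi> (F - {v}))(v := c)) = colouring_weight F P \<phi>"
      by (simp only: restore)
  next
    fix \<phi> assume \<phi>_in: "\<phi> \<in> ?B"
    then have \<phi>_PiE: "\<phi> \<in> (F - {v}) \<rightarrow>\<^sub>E {1..k}" by simp
    show "restrict (\<phi>(v := c)) (F - {v}) = \<phi>"
      using PiE_arb[OF \<phi>_PiE] by (auto simp: fun_eq_iff restrict_def)
    have "\<phi>(v := c) \<in> F \<rightarrow>\<^sub>E {1..k}"
      using \<phi>_PiE colour v_in by (auto simp: PiE_iff extensional_def)
    then show "\<phi>(v := c) \<in> ?A"
      unfolding A_eq using \<phi>_in W_nth by auto
  qed
  then show ?thesis
    by (simp only: colouring_weight_upd[OF F_sub v_in(1)] pinned_Zr_def sum_distrib_left)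
qed

lemma pinned_Z_upd_eq_sum:
  assumes F_sub: "F \<subseteq> V" and v_in: "v \<in> F"
  shows "pinned_Z F (P(v := p)) =
    (\<Sum>c\<in>{1..k}. pin_weight p c * pinned_Z (F - {v}) (attach_pins P (nbrs v) v c))"
proof -
  have finite: "finite (F \<rightarrow>\<^sub>E {1..k})"
    using finite_subset_V[OF F_sub] by (intro finite_PiE) auto
  have colours: "(\<lambda>\<phi>. \<phi> v) ` (F \<rightarrow>\<^sub>E {1..k}) \<subseteq> {1..k}"
    using v_in by (auto dest: PiE_mem)
  have "pinned_Z F (P(v := p)) =
      (\<Sum>c\<in>{1..k}. \<Sum>\<phi> \<in> {\<phi> \<in> F \<rightarrow>\<^sub>E {1..k}. \<phi> v = c}. colouring_weight F (P(v := p)) \<phi>)"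
    using sum.group[OF finite _ colours, of "colouring_weight F (P(v := p))"]
    by (simp add: pinned_Zr_def)
  also have "\<dots> = (\<Sum>c\<in>{1..k}. pinned_Zr F (P(v := p)) [v] [c])"
    by (simp add: pinned_Zr_def)
  also have "\<dots> = (\<Sum>c\<in>{1..k}. pin_weight p c *
      pinned_Z (F - {v}) (attach_pins (P(v := p)) (nbrs v) v c))"
    using v_in by (intro sum.cong refl) (simp add: pinned_Zr_Cons[OF F_sub])
  also have "\<dots> = (\<Sum>c\<in>{1..k}. pin_weight p c * pinned_Z (F - {v}) (attach_pins P (nbrs v) v c))"
    by (intro sum.cong refl arg_cong2[of _ _ _ _ "(*)"] pinned_Zr_cong) (simp add: attach_pins_def)
  finally show ?thesis .
qed

definition boundary_pins :: "'a list \<Rightarrow> nat list \<Rightarrow> 'a \<Rightarrow> pin_list" where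
  "boundary_pins W L x =
     map (\<lambda>(v, c). (w {v, x}, c)) (filter (\<lambda>(v, c). x \<in> nbrs v) (zip W L))"

lemma boundary_pins_Nil: "boundary_pins [] [] = (\<lambda>_. [])"
  by (simp add: boundary_pins_def fun_eq_iff)

lemma boundary_pins_snoc:
  "length W = length L \<Longrightarrow>
    boundary_pins (W @ [u]) (L @ [c]) = attach_pins (boundary_pins W L) (nbrs u) u c"
  by (simp add: boundary_pins_def attach_pins_def fun_eq_iff)

lemma set_boundary_pins:
  assumes "length W = length L"
  shows "set (boundary_pins W L u) = {(w {u, W ! i}, L ! i) | i. i < length W \<and> adj Es u (W ! i)}"
  using assms
  by (fastforce simp: boundary_pins_def set_zip nbrs_def adj_def insert_commute image_iff)

lemma good_colour_iff:
  "length W = length L \<Longrightarrow> good_colour Es W L u l \<longleftrightarrow> l \<notin> snd ` set (boundary_pins W L u)"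
  by (auto simp: good_colour_def set_boundary_pins image_iff)

lemma Zr_append_eq_pinned_Zr:
  assumes "distinct (W @ W')" "set (W @ W') \<subseteq> V" "length W = length L" "set L \<subseteq> {1..k}"
    and "independent (set W)"
  shows "Zr k V Es w (W @ W') (L @ L') = pinned_Zr (V - set W) (boundary_pins W L) W' L'"
  using assms
proof (induction W arbitrary: L W' L' rule: rev_induct)
  case Nil
  then show ?case
    by (simp add: Zr_eq_pinned_Zr boundary_pins_Nil)
next
  case (snoc u W)
  obtain L0 c where L_eq: "L = L0 @ [c]" "length W = length L0"
    using snoc.prems(3) by (cases L rule: rev_cases) auto
  have "boundary_pins W L0 u = []"
    using snoc.prems(5)
    by (auto simp: boundary_pins_def independent_def filter_empty_conv dest: set_zip_leftD)
  moreover have "Zr k V Es w (W @ u # W') (L0 @ c # L') =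
      pinned_Zr (V - set W) (boundary_pins W L0) (u # W') (c # L')"
    using snoc.prems L_eq by (intro snoc.IH) (auto simp: independent_def)
  moreover have "pinned_Zr (V - set W) (boundary_pins W L0) (u # W') (c # L') =
      pin_weight (boundary_pins W L0 u) c *
      pinned_Zr (V - set W - {u}) (boundary_pins (W @ [u]) L) W' L'"
    using snoc.prems L_eq by (subst pinned_Zr_Cons) (auto simp: boundary_pins_snoc)
  moreover have "V - set W - {u} = V - set (W @ [u])"
    by auto
  ultimately show ?case
    by (simp add: L_eq(1))
qed

end

section \<open>Zero-freeness and stability under recolouring\<close>

locale zero_free_potts = potts_model k V Es w + potts_parameters D k eps K \<theta>
  for D k :: nat and eps K \<theta> :: real
    and V :: "'a set" and Es :: "'a set set" and w :: "'a set \<Rightarrow> complex" +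
  assumes max_degree: "max_degree_le V Es D"
    and weights: "\<And>e. e \<in> Es \<Longrightarrow>
        cmod (w e) \<le> eps \<or> (\<bar>Arg (w e)\<bar> \<le> eps * \<theta> \<and> eps < cmod (w e) \<and> cmod (w e) \<le> 1)"
begin

lemma admissible_weight_edge: "x \<in> nbrs v \<Longrightarrow> admissible_weight (w {v, x})"
  using weights by (auto simp: nbrs_def adj_def admissible_weight_def)

definition admissible_pins :: "'a set \<Rightarrow> ('a \<Rightarrow> pin_list) \<Rightarrow> bool" where
  "admissible_pins F P \<longleftrightarrow>
     (\<forall>x\<in>F. card (nbrs x \<inter> F) + length (P x) \<le> D \<and> admissible_pin_list (P x))"

lemma admissible_pinsD:
  assumes "admissible_pins F P" "x \<in> F"
  shows "card (nbrs x \<inter> F) + length (P x) \<le> D" "admissible_pin_list (P x)"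
  using assms by (auto simp: admissible_pins_def)

definition nonvanishing :: "'a set \<Rightarrow> bool" where
  "nonvanishing F \<longleftrightarrow> (\<forall>P. admissible_pins F P \<longrightarrow> pinned_Z F P \<noteq> 0)"

definition recolouring_stable :: "'a set \<Rightarrow> bool" where
  "recolouring_stable F \<longleftrightarrow>
     (\<forall>P. \<forall>x\<in>F. \<forall>a. \<forall>l\<in>{1..k}. \<forall>j\<in>{1..k}. admissible_pins F (add_pin P x a l) \<longrightarrow>
       pinned_Z F (add_pin P x a l) / pinned_Z F (add_pin P x a j) \<in> ball 1 K)"

lemma admissible_attach_pins_recolour:
  "admissible_pins F (attach_pins P S v l) \<Longrightarrow> admissible_pins F (attach_pins P S v j)"
  by (auto simp: admissible_pins_def attach_pins_def split: if_splits)

lemma admissible_attach_pins: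
  assumes F_sub: "F \<subseteq> V" and v_in: "v \<in> F" and admissible: "admissible_pins F P"
  shows "admissible_pins (F - {v}) (attach_pins P (nbrs v) v c)"
  unfolding admissible_pins_def
proof (intro ballI)
  fix x assume "x \<in> F - {v}"
  then have old: "card (nbrs x \<inter> F) + length (P x) \<le> D" "admissible_pin_list (P x)"
    using admissible_pinsD[OF admissible] by auto
  have finite: "finite (nbrs x \<inter> F)"
    using finite_subset_V[OF F_sub] by simp
  show "card (nbrs x \<inter> (F - {v})) + length (attach_pins P (nbrs v) v c x) \<le> D
      \<and> admissible_pin_list (attach_pins P (nbrs v) v c x)"
  proof (cases "x \<in> nbrs v")
    case True
    then have "v \<in> nbrs x \<inter> F"
      using v_in by (simp add: nbrs_sym)
    then have "card (nbrs x \<inter> F) = Suc (card (nbrs x \<inter> (F - {v})))"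
      using finite card_Suc_Diff1[of "nbrs x \<inter> F" v] by (simp add: Int_Diff)
    then show ?thesis
      using old admissible_weight_edge[OF True] by (simp add: attach_pins_def)
  next
    case False
    have "card (nbrs x \<inter> (F - {v})) \<le> card (nbrs x \<inter> F)"
      using finite by (intro card_mono) auto
    then show ?thesis
      using old False by (simp add: attach_pins_def)
  qed
qed

lemma attach_pins_ratio_in_ball_pow:
  assumes stable: "nonvanishing F" "recolouring_stable F"
    and "finite S" "S \<subseteq> F" "admissible_pins F (attach_pins P S v l)"
    and colours: "l \<in> {1..k}" "j \<in> {1..k}"
  shows "pinned_Z F (attach_pins P S v l) / pinned_Z F (attach_pins P S v j) \<in> ball_pow 1 K (card S)"
  using assms(3-5)
proof (induction S arbitrary: P)
  case empty
  then have "pinned_Z F P \<noteq> 0"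
    using stable(1) by (simp add: attach_pins_empty nonvanishing_def)
  then show ?case
    by (simp add: attach_pins_empty)
next
  case (insert x S)
  define a where "a = w {v, x}"
  define Q where "Q = attach_pins P S v j"
  have insert_l: "attach_pins P (insert x S) v l = attach_pins (add_pin P x a l) S v l"
    and mixed: "attach_pins (add_pin P x a l) S v j = add_pin Q x a l"
    and insert_j: "attach_pins P (insert x S) v j = add_pin Q x a j"
    by (simp_all only: a_def Q_def attach_pins_insert[OF insert.hyps(2)]
        attach_pins_add_pin[OF insert.hyps(2)])
  have "admissible_pins F (attach_pins (add_pin P x a l) S v l)"
    using insert.prems(2) by (simp only: insert_l)
  then have admissible: "admissible_pins F (add_pin Q x a l)"
    unfolding mixed[symmetric] by (rule admissible_attach_pins_recolour)
  have "pinned_Z F (attach_pins P (insert x S) v l) / pinned_Z F (add_pin Q x a l)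
      \<in> ball_pow 1 K (card S)" (is "?first \<in> _")
    using insert.prems insert.IH[of "add_pin P x a l"] by (simp add: insert_l mixed)
  moreover have "pinned_Z F (add_pin Q x a l) / pinned_Z F (attach_pins P (insert x S) v j)
      \<in> ball 1 K" (is "?second \<in> _")
    using stable(2) insert.prems colours admissible unfolding insert_j recolouring_stable_def
    by blast
  ultimately have "?first * ?second \<in> ball_pow 1 K (Suc (card S))"
    by (rule mult_in_ball_pow_Suc)
  moreover have "pinned_Z F (add_pin Q x a l) \<noteq> 0"
    using stable(1) admissible by (simp add: nonvanishing_def)
  ultimately show ?case
    using insert.hyps by simp
qed

lemma attach_nbrs_ratios_in_ball_pow:
  assumes F_sub: "F \<subseteq> V" and v_in: "v \<in> F" and admissible: "admissible_pins F P"
    and stable: "nonvanishing (F - {v})" "recolouring_stable (F - {v})"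
  shows "ratios_in_ball_pow (card (nbrs v \<inter> F))
    (\<lambda>c. pinned_Z (F - {v}) (attach_pins P (nbrs v) v c))"
  unfolding ratios_in_ball_pow_def
proof (intro ballI)
  fix l j assume colours: "l \<in> {1..k}" "j \<in> {1..k}"
  have restrict: "pinned_Z (F - {v}) (attach_pins P (nbrs v) v c) =
      pinned_Z (F - {v}) (attach_pins P (nbrs v \<inter> F) v c)" for c
    by (intro pinned_Zr_cong) (auto simp: attach_pins_def)
  have "admissible_pins (F - {v}) (attach_pins P (nbrs v \<inter> F) v l)"
    using admissible_attach_pins[OF F_sub v_in admissible, of l]
    by (simp add: admissible_pins_def attach_pins_def)
  then show "pinned_Z (F - {v}) (attach_pins P (nbrs v) v l) /
      pinned_Z (F - {v}) (attach_pins P (nbrs v) v j) \<in> ball_pow 1 K (card (nbrs v \<inter> F))"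
    unfolding restrict using stable colours finite_subset_V[OF F_sub] not_in_nbrs_self
    by (intro attach_pins_ratio_in_ball_pow) auto
qed

lemma nonvanishing_step:
  assumes "F \<subseteq> V" "v \<in> F" "nonvanishing (F - {v})" "recolouring_stable (F - {v})"
  shows "nonvanishing F"
  unfolding nonvanishing_def
proof (intro allI impI)
  fix P assume admissible: "admissible_pins F P"
  show "pinned_Z F P \<noteq> 0"
    using pin_weighted_sum_nonzero[OF admissible_pinsD(2,1)[OF admissible assms(2)]
        attach_nbrs_ratios_in_ball_pow[OF assms(1,2) admissible assms(3,4)]]
      pinned_Z_upd_eq_sum[OF assms(1,2), of P "P v"]
    by simp
qed

lemma recolouring_stable_step:
  assumes F_sub: "F \<subseteq> V"
    and stable: "\<And>v. v \<in> F \<Longrightarrow> nonvanishing (F - {v}) \<and> recolouring_stable (F - {v})"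
  shows "recolouring_stable F"
  unfolding recolouring_stable_def
proof (intro allI ballI impI)
  fix P v a l j
  assume v_in: "v \<in> F" and colours: "l \<in> {1..k}" "j \<in> {1..k}"
    and admissible: "admissible_pins F (add_pin P v a l)"
  define X where "X c = pinned_Z (F - {v}) (attach_pins (add_pin P v a l) (nbrs v) v c)" for c
  have ratios: "ratios_in_ball_pow (card (nbrs v \<inter> F)) X"
    unfolding X_def using attach_nbrs_ratios_in_ball_pow[OF F_sub v_in admissible] stable[OF v_in]
    by blast
  have expand: "pinned_Z F (add_pin P v a i) =
      (\<Sum>c\<in>{1..k}. pin_weight (P v @ [(a, i)]) c * X c)" for i
    using pinned_Z_upd_eq_sum[OF F_sub v_in, of "add_pin P v a l" "P v @ [(a, i)]"]
    by (simp add: X_def add_pin_def)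
  show "pinned_Z F (add_pin P v a l) / pinned_Z F (add_pin P v a j) \<in> ball 1 K"
    unfolding expand using admissible_pinsD[OF admissible v_in] ratios colours
    by (intro recolour_pin_ratio_in_ball[where d = "card (nbrs v \<inter> F)"])
       (simp_all add: add_pin_def)
qed

theorem nonvanishing_and_recolouring_stable:
  assumes "F \<subseteq> V"
  shows "nonvanishing F \<and> recolouring_stable F"
  using finite_subset_V[OF assms] assms
proof (induction F rule: finite_psubset_induct)
  case (psubset F)
  have IH: "nonvanishing (F - {v}) \<and> recolouring_stable (F - {v})" if "v \<in> F" for v
    using that psubset by (intro psubset.IH) auto
  have "nonvanishing F"
  proof (cases "F = {}")
    case True
    then show ?thesis
      by (simp add: nonvanishing_def pinned_Z_empty)
  next
    case False
    then show ?thesis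
      using IH nonvanishing_step[OF psubset.prems] by blast
  qed
  then show ?case
    using recolouring_stable_step[OF psubset.prems IH] by simp
qed

lemma admissible_boundary_pins:
  assumes "distinct W" "set W \<subseteq> V" "length W = length L"
  shows "admissible_pins (V - set W) (boundary_pins W L)"
  using assms
proof (induction W arbitrary: L rule: rev_induct)
  case Nil
  have "card (nbrs x \<inter> V) \<le> D" if "x \<in> V" for x
    using max_degree that nbrs_subset[of x]
    by (auto simp: max_degree_le_def degree_eq_card_nbrs Int_absorb2)
  then show ?case
    using Nil by (simp add: admissible_pins_def boundary_pins_Nil)
next
  case (snoc u W)
  obtain L0 c where L_eq: "L = L0 @ [c]" "length W = length L0"
    using snoc.prems(3) by (cases L rule: rev_cases) auto
  have "admissible_pins (V - set W - {u}) (attach_pins (boundary_pins W L0) (nbrs u) u c)"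
    using snoc L_eq by (intro admissible_attach_pins) auto
  moreover have "V - set W - {u} = V - set (W @ [u])"
    by auto
  ultimately show ?case
    by (simp add: L_eq boundary_pins_snoc)
qed

lemma Zr_leaf_independent_nonzero:
  assumes "distinct W" "leaf_independent V Es (set W)" "length L = length W" "set L \<subseteq> {1..k}"
  shows "Zr k V Es w W L \<noteq> 0"
proof -
  have "Zr k V Es w W L = pinned_Z (V - set W) (boundary_pins W L)"
    using Zr_append_eq_pinned_Zr[of W "[]" L "[]"] assms leaf_independentD(1,2) by simp
  moreover have "admissible_pins (V - set W) (boundary_pins W L)"
    using assms leaf_independentD(1) by (intro admissible_boundary_pins) auto
  ultimately show ?thesis
    using nonvanishing_and_recolouring_stable[of "V - set W"] by (auto simp: nonvanishing_def)
qed

lemma Zr_leaf_ratio_in_ball: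
  assumes distinct: "distinct (W @ [u])" and leaf: "leaf_independent V Es (set (W @ [u]))"
    and L_colours: "length L = length W" "set L \<subseteq> {1..k}" and colours: "l \<in> {1..k}" "j \<in> {1..k}"
  shows "Zr k V Es w (W @ [u]) (L @ [l]) / Zr k V Es w (W @ [u]) (L @ [j]) \<in> ball 1 K"
proof -
  define F where "F = V - set (W @ [u])"
  obtain v where nbrs_u: "nbrs u = {v}"
    using leaf_independentD(3)[OF leaf, of u] by (auto simp: card_1_singleton_iff)
  define P where "P c = add_pin (boundary_pins W L) v (w {u, v}) c" for c
  have "v \<in> F"
    using nbrs_u nbrs_subset[of u] leaf_independentD(2)[OF leaf]
    by (auto simp: F_def independent_def)
  have P_eq: "boundary_pins (W @ [u]) (L @ [c]) = P c" for c
    using L_colours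
    by (auto simp: boundary_pins_snoc P_def attach_pins_def add_pin_def nbrs_u fun_eq_iff)
  have Zr_eq: "Zr k V Es w (W @ [u]) (L @ [c]) = pinned_Z F (P c)" if "c \<in> {1..k}" for c
    using Zr_append_eq_pinned_Zr[of "W @ [u]" "[]" "L @ [c]" "[]"] distinct L_colours that
      leaf_independentD(1,2)[OF leaf] by (simp add: P_eq F_def)
  have "admissible_pins F (P l)"
    unfolding P_eq[symmetric] F_def using distinct L_colours leaf_independentD(1)[OF leaf]
    by (intro admissible_boundary_pins) auto
  moreover have "recolouring_stable F"
    using nonvanishing_and_recolouring_stable[of F] by (simp add: F_def)
  ultimately show ?thesis
    using \<open>v \<in> F\<close> colours
    unfolding Zr_eq[OF colours(1)] Zr_eq[OF colours(2)] P_def recolouring_stable_def by blast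
qed

lemma good_or_neutral_iff_not_bad:
  assumes "length W = length L"
  shows "good_colour Es W L u l \<or> neutral_colour Es w eps W L u l \<longleftrightarrow>
    \<not> pinned_bad (boundary_pins W L u) l"
proof -
  have "pinned_bad (boundary_pins W L u) l \<longleftrightarrow> bad_colour Es w eps W L u l"
    unfolding pinned_bad_def bad_colour_def set_boundary_pins[OF assms] by auto
  then show ?thesis
    by (auto simp: good_colour_def neutral_colour_def bad_colour_def)
qed

context
  fixes W u L
  assumes distinct: "distinct (W @ [u])" and u_in: "u \<in> V"
    and leaf: "leaf_independent V Es (set W)"
    and L_colours: "length L = length W" "set L \<subseteq> {1..k}"
begin

abbreviation (input) free_degree :: nat where
  "free_degree \<equiv> card {v \<in> V. adj Es u v \<and> v \<notin> set W}"

lemma free_degree_eq: "free_degree = card (nbrs u \<inter> (V - set W))"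
  by (rule arg_cong[of _ _ card]) (auto simp: nbrs_def)

lemma admissible_free_boundary: "admissible_pins (V - set W) (boundary_pins W L)"
  using distinct leaf_independentD(1)[OF leaf] L_colours by (intro admissible_boundary_pins) auto

lemma admissible_pin_list_boundary: "admissible_pin_list (boundary_pins W L u)"
  using admissible_pinsD(2)[OF admissible_free_boundary] distinct u_in by simp

lemma length_boundary_pins_le: "length (boundary_pins W L u) \<le> D - free_degree"
  using admissible_pinsD(1)[OF admissible_free_boundary, of u] distinct u_in
  by (simp add: free_degree_eq)

lemma Zr_snoc_factorisationE:
  obtains X where "ratios_in_ball_pow free_degree X"
    and "\<forall>c\<in>{1..k}. Zr k V Es w (W @ [u]) (L @ [c]) = pin_weight (boundary_pins W L u) c * X c"
proof
  let ?F = "V - set W" and ?P = "boundary_pins W L"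
  let ?X = "\<lambda>c. pinned_Z (?F - {u}) (attach_pins ?P (nbrs u) u c)"
  show "ratios_in_ball_pow free_degree ?X"
    unfolding free_degree_eq
    using distinct u_in admissible_free_boundary nonvanishing_and_recolouring_stable[of "?F - {u}"]
    by (intro attach_nbrs_ratios_in_ball_pow) auto
  show "\<forall>c\<in>{1..k}. Zr k V Es w (W @ [u]) (L @ [c]) = pin_weight (?P u) c * ?X c"
  proof
    fix c assume colour: "c \<in> {1..k}"
    have "Zr k V Es w (W @ [u]) (L @ [c]) = pinned_Zr ?F ?P [u] [c]"
      using distinct u_in L_colours leaf_independentD(1,2)[OF leaf]
      by (intro Zr_append_eq_pinned_Zr) auto
    also have "\<dots> = pin_weight (?P u) c * ?X c"
      using distinct u_in colour by (intro pinned_Zr_Cons) auto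
    finally show "Zr k V Es w (W @ [u]) (L @ [c]) = pin_weight (?P u) c * ?X c" .
  qed
qed

lemma Zr_snoc_nonzero:
  assumes "l \<in> {1..k}" "good_colour Es W L u l \<or> neutral_colour Es w eps W L u l"
  shows "Zr k V Es w (W @ [u]) (L @ [l]) \<noteq> 0"
proof -
  obtain X where ratios: "ratios_in_ball_pow free_degree X" and "\<forall>c\<in>{1..k}.
      Zr k V Es w (W @ [u]) (L @ [c]) = pin_weight (boundary_pins W L u) c * X c"
    by (rule Zr_snoc_factorisationE)
  then show ?thesis
    using assms L_colours good_or_neutral_iff_not_bad[of W L u l]
    by (simp add: pin_weight_nonzero ratios_in_ball_pow_nonzero[OF ratios])
qed

lemma cangle_Zr_snoc_le:
  assumes "l \<in> {1..k}" "good_colour Es W L u l \<or> neutral_colour Es w eps W L u l"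
    and "j \<in> {1..k}" "good_colour Es W L u j \<or> neutral_colour Es w eps W L u j"
  shows "cangle (Zr k V Es w (W @ [u]) (L @ [l])) (Zr k V Es w (W @ [u]) (L @ [j]))
    \<le> (real free_degree + real (D - free_degree) * eps) * \<theta>"
proof -
  obtain X where ratios: "ratios_in_ball_pow free_degree X" and Zr_eq: "\<forall>c\<in>{1..k}.
      Zr k V Es w (W @ [u]) (L @ [c]) = pin_weight (boundary_pins W L u) c * X c"
    by (rule Zr_snoc_factorisationE)
  have "\<not> pinned_bad (boundary_pins W L u) l" "\<not> pinned_bad (boundary_pins W L u) j"
    using assms L_colours good_or_neutral_iff_not_bad by simp_all
  from abs_Arg_pin_weight_ratio_mult_le[OF admissible_pin_list_boundary this
      length_boundary_pins_le ratios_in_ball_powD[OF ratios assms(1,3)]]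
  show ?thesis
    using assms by (simp add: cangle_def Zr_eq)
qed

lemma Zr_snoc_ratio_in_ball_pow:
  assumes "l \<in> {1..k}" "good_colour Es W L u l" "j \<in> {1..k}" "good_colour Es W L u j"
  shows "Zr k V Es w (W @ [u]) (L @ [l]) / Zr k V Es w (W @ [u]) (L @ [j])
    \<in> ball_pow 1 K free_degree"
proof -
  obtain X where ratios: "ratios_in_ball_pow free_degree X" and Zr_eq: "\<forall>c\<in>{1..k}.
      Zr k V Es w (W @ [u]) (L @ [c]) = pin_weight (boundary_pins W L u) c * X c"
    by (rule Zr_snoc_factorisationE)
  have "pin_weight (boundary_pins W L u) l = 1" "pin_weight (boundary_pins W L u) j = 1"
    using assms L_colours by (simp_all add: good_colour_iff pin_weight_eq_1)
  then show ?thesis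
    using ratios_in_ball_powD[OF ratios] assms by (simp add: Zr_eq)
qed

end

end

theorem theorem3p1:
  fixes D k :: nat and eps K \<theta> :: real
    and V :: "'a set" and Es :: "'a set set" and w :: "'a set \<Rightarrow> complex"
  assumes D3: "D \<ge> 3"
    and kD: "k > D"
    and eps: "0 < eps" "eps < 1"
    and K: "0 < K" "K < 1 / (real D - 1)"
    and theta_def: "\<theta> = arcsin K"
    and theta: "0 < \<theta>" "\<theta> < pi / (3 * (real D - 1 + eps))"
    and cond: "\<And>d. d \<le> D - 1 \<Longrightarrow>
        0 < (1 + eps)^2 / ((real k - real (D - d)) * (1 - K)^d - eps * real (D - d))
      \<and> (1 + eps)^2 / ((real k - real (D - d)) * (1 - K)^d - eps * real (D - d)) \<le> K"
    and G: "simple_graph V Es"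
    and maxdeg: "max_degree_le V Es D"
    and weights: "\<And>e. e \<in> Es \<Longrightarrow>
        cmod (w e) \<le> eps \<or> (\<bar>Arg (w e)\<bar> \<le> eps * \<theta> \<and> eps < cmod (w e) \<and> cmod (w e) \<le> 1)"
  shows
    \<comment> \<open>(A)\<close>
    "(\<forall>W L. distinct W \<and> leaf_independent V Es (set W) \<and> length L = length W
        \<and> set L \<subseteq> {1..k} \<longrightarrow> Zr k V Es w W L \<noteq> 0)
    \<and>
    \<comment> \<open>(B)\<close>
    (\<forall>W' u L' l l'. distinct (W' @ [u]) \<and> leaf_independent V Es (set (W' @ [u]))
        \<and> length L' = length W' \<and> set L' \<subseteq> {1..k} \<and> l \<in> {1..k} \<and> l' \<in> {1..k} \<longrightarrow>
        cangle (Zr k V Es w (W' @ [u]) (L' @ [l])) (Zr k V Es w (W' @ [u]) (L' @ [l'])) \<le> \<theta>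
      \<and> Zr k V Es w (W' @ [u]) (L' @ [l]) / Zr k V Es w (W' @ [u]) (L' @ [l']) \<in> ball 1 K)
    \<and>
    \<comment> \<open>(C)\<close>
    (\<forall>W' u L'. distinct (W' @ [u]) \<and> u \<in> V \<and> leaf_independent V Es (set W')
        \<and> length L' = length W' \<and> set L' \<subseteq> {1..k} \<longrightarrow>
       (let d = card {v \<in> V. adj Es u v \<and> v \<notin> set W'}; b = D - d;
            GN = {l \<in> {1..k}. good_colour Es W' L' u l \<or> neutral_colour Es w eps W' L' u l};
            Gd = {l \<in> {1..k}. good_colour Es W' L' u l}
        in (\<forall>l\<in>GN. Zr k V Es w (W' @ [u]) (L' @ [l]) \<noteq> 0)
         \<and> (\<forall>l\<in>GN. \<forall>l'\<in>GN. cangle (Zr k V Es w (W' @ [u]) (L' @ [l]))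
                                    (Zr k V Es w (W' @ [u]) (L' @ [l'])) \<le> (real d + real b * eps) * \<theta>)
         \<and> (\<forall>l\<in>Gd. \<forall>j\<in>Gd. Zr k V Es w (W' @ [u]) (L' @ [l]) / Zr k V Es w (W' @ [u]) (L' @ [j])
                                \<in> ball_pow 1 K d)))"
proof -
  interpret zero_free_potts D k eps K \<theta> V Es w
    by unfold_locales (fact assms)+
  show ?thesis
  proof ((intro conjI allI impI; (elim conjE)?), goal_cases nonzero angle ratio fixed_vertex)
    case (nonzero W L)
    then show ?case
      by (rule Zr_leaf_independent_nonzero)
  next
    case (angle W' u L' l l')
    then have "Zr k V Es w (W' @ [u]) (L' @ [l]) / Zr k V Es w (W' @ [u]) (L' @ [l']) \<in> ball 1 K"
      by (rule Zr_leaf_ratio_in_ball)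
    then show ?case
      using abs_Arg_le_arcsin[OF _ K_less_1]
      by (simp add: cangle_def theta_def dist_norm norm_minus_commute)
  next
    case (ratio W' u L' l l')
    then show ?case
      by (rule Zr_leaf_ratio_in_ball)
  next
    case (fixed_vertex W' u L')
    show ?case
      unfolding Let_def
      using Zr_snoc_nonzero[OF fixed_vertex] cangle_Zr_snoc_le[OF fixed_vertex]
        Zr_snoc_ratio_in_ball_pow[OF fixed_vertex] by blast
  qed
qed

end
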